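(* For every hypergraph $\mathcal{H}$, $$\eta(\mathrm{I}(\mathcal{H})) \geq \max\left\{\left\lceil\frac{\tilde{\gamma}(\mathcal{H})}{2}\right\rceil, \gamma_{si}(\mathcal{H}), \gamma_E(\mathcal{H})\right\}.$$
   Context: A hypergraph $\mathcal{H}$ on a finite vertex set $V=V(\mathcal{H})$ is a collection of distinct non-empty subsets of $V$, called edges. A singleton edge $\{v\}$ is called a loop. A vertex is isolated if no edge contains it. A set $W\subseteq V$ is independent if it contains no edge of $\mathcal{H}$. The independence complex $\mathrm{I}(\mathcal{H})$ is the abstract simplicial complex on $V$ whose faces are the independent sets. Connectivity: reduced homology $\tilde{H}_i$ is taken with coefficients in $\mathbb{Z}_2$. A simplicial complex $K$ is $k$-connected (homologically) if $\tilde{H}_i(K)=0$ for all $-1\le i\le k$. $\eta(K)$ is the maximal integer $k$ for which $K$ is $(k-2)$-connected, and $\eta(K)=\infty$ if there is no such maximal $k$. (The complex $\{\emptyset\}$ has $\tilde{H}_{-1}$ of rank 1.) Domination: $W\subseteq V$ dominates a vertex $v$ if there is $W'\subseteq W\setminus\{v\}$ with $W'\cup\{v\}\in\mathcal{H}$ (in particular the empty set dominates $v$ if $\{v\}$ is a loop). $W$ dominates $A\subseteq V$ if it dominates every vertex of $A$. Let $\gamma(\mathcal{H};A)=\min\{|W| : W\subseteq V,\ W \text{ dominates } A\}$ and $\tilde{\gamma}(\mathcal{H})=\gamma(\mathcal{H};V)$. A set $A\subseteq V$ is strongly independent if it is independent and every edge contains at most one vertex of $A$. Let $\gamma_{si}(\mathcal{H})=\max\{\gamma(\mathcal{H};A)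 : A \text{ strongly independent in } \mathcal{H}\}$. Let $\gamma_E(\mathcal{H})=\min\{|\mathcal{F}| : \mathcal{F}\subseteq\mathcal{H},\ \bigcup_{F\in\mathcal{F}}F \text{ dominates } V\}$. If $\mathcal{H}$ has an isolated vertex, all of $\tilde{\gamma}(\mathcal{H}),\gamma_{si}(\mathcal{H}),\gamma_E(\mathcal{H})$ are defined to be $\infty$. *)

theory Defs
  imports
    "HOL-Library.Z2"
    "HOL-Library.Extended_Nat"
    "HOL-Algebra.Elementary_Groups"
begin

definition hypergraph :: "'a set \<Rightarrow> 'a set set \<Rightarrow> bool" where
  "hypergraph V H \<longleftrightarrow> finite V \<and> (\<forall>e\<in>H. e \<subseteq> V \<and> e \<noteq> {})"

definition has_isolated_vertex :: "'a set \<Rightarrow> 'a set set \<Rightarrow> bool" where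
  "has_isolated_vertex V H \<longleftrightarrow> (\<exists>v\<in>V. \<forall>e\<in>H. v \<notin> e)"

definition independent :: "'a set \<Rightarrow> 'a set set \<Rightarrow> 'a set \<Rightarrow> bool" where
  "independent V H W \<longleftrightarrow> W \<subseteq> V \<and> \<not> (\<exists>e\<in>H. e \<subseteq> W)"

definition independence_complex :: "'a set \<Rightarrow> 'a set set \<Rightarrow> 'a set set" where
  "independence_complex V H = {W. independent V H W}"

text \<open>
  Reduced simplicial homology over \<open>\<int>\<^sub>2\<close> (the field \<^typ>\<open>bit\<close>) of a finite simplicial complex
  \<open>K\<close>, given as the set of its faces, the empty face included. An \<open>i\<close>-chain is a function
  supported on the faces with \<open>i + 1\<close> elements, so that the empty face has dimension \<open>-1\<close>.
  The coefficient of the face \<open>\<tau>\<close> in the boundary of \<open>c\<close> is the sum of the coefficients of \<open>c\<close>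
  at the faces obtained from \<open>\<tau>\<close> by adding one vertex; for \<open>\<tau> = {}\<close> this is the augmentation.
\<close>

definition chains :: "'a set set \<Rightarrow> int \<Rightarrow> ('a set \<Rightarrow> bit) set" where
  "chains K i = {c. \<forall>\<sigma>. c \<sigma> \<noteq> 0 \<longrightarrow> \<sigma> \<in> K \<and> int (card \<sigma>) = i + 1}"

definition chain_boundary :: "'a set set \<Rightarrow> ('a set \<Rightarrow> bit) \<Rightarrow> 'a set \<Rightarrow> bit" where
  "chain_boundary K c \<tau> = (\<Sum>\<sigma> \<in> {\<sigma> \<in> K. \<exists>v. v \<notin> \<tau> \<and> \<sigma> = insert v \<tau>}. c \<sigma>)"

definition cycles :: "'a set set \<Rightarrow> int \<Rightarrow> ('a set \<Rightarrow> bit) set" where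
  "cycles K i = {c \<in> chains K i. chain_boundary K c = (\<lambda>_. 0)}"

definition boundaries :: "'a set set \<Rightarrow> int \<Rightarrow> ('a set \<Rightarrow> bit) set" where
  "boundaries K i = chain_boundary K ` chains K (i + 1)"

definition cycle_group :: "'a set set \<Rightarrow> int \<Rightarrow> ('a set \<Rightarrow> bit) monoid" where
  "cycle_group K i = \<lparr>carrier = cycles K i, mult = (\<lambda>c d \<sigma>. c \<sigma> + d \<sigma>), one = (\<lambda>_. 0)\<rparr>"

definition reduced_homology :: "'a set set \<Rightarrow> int \<Rightarrow> ('a set \<Rightarrow> bit) set monoid" where
  "reduced_homology K i = cycle_group K i Mod boundaries K i"

definition homologically_connected :: "int \<Rightarrow> 'a set set \<Rightarrow> bool" where
  "homologically_connected k K \<longleftrightarrow>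
     (\<forall>i. -1 \<le> i \<and> i \<le> k \<longrightarrow> trivial_group (reduced_homology K i))"

text \<open>
  Every complex is vacuously \<open>(k - 2)\<close>-connected for \<open>k \<le> 0\<close>, so a maximal \<open>k\<close> is never negative
  and \<^const>\<open>nat\<close> loses nothing.
\<close>

definition eta :: "'a set set \<Rightarrow> enat" where
  "eta K =
     (if \<exists>k. homologically_connected (k - 2) K \<and>
             (\<forall>j. homologically_connected (j - 2) K \<longrightarrow> j \<le> k)
      then enat (nat (GREATEST k. homologically_connected (k - 2) K))
      else \<infinity>)"

definition dominates_vertex :: "'a set set \<Rightarrow> 'a set \<Rightarrow> 'a \<Rightarrow> bool" where
  "dominates_vertex H W v \<longleftrightarrow> (\<exists>W' \<subseteq> W - {v}. W' \<union> {v} \<in> H)"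

definition dominates :: "'a set set \<Rightarrow> 'a set \<Rightarrow> 'a set \<Rightarrow> bool" where
  "dominates H W A \<longleftrightarrow> (\<forall>v\<in>A. dominates_vertex H W v)"

text \<open>
  The infima below are minima of sets of natural numbers, which are nonempty when no vertex is
  isolated (take \<open>W = V\<close>, respectively \<open>F = H\<close>). The maximum over strongly independent sets
  always ranges over a nonempty set, since the empty set is one.
\<close>

definition domination_number :: "'a set \<Rightarrow> 'a set set \<Rightarrow> 'a set \<Rightarrow> enat" where
  "domination_number V H A = (INF W \<in> {W. W \<subseteq> V \<and> dominates H W A}. enat (card W))"

definition gamma_tilde :: "'a set \<Rightarrow> 'a set set \<Rightarrow> enat" where
  "gamma_tilde V H = (if has_isolated_vertex V H then \<infinity> else domination_number V H V)"

definition strongly_independent :: "'a set \<Rightarrow> 'a set set \<Rightarrow> 'a set \<Rightarrow> bool" where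
  "strongly_independent V H A \<longleftrightarrow> independent V H A \<and> (\<forall>e\<in>H. card (e \<inter> A) \<le> 1)"

definition gamma_si :: "'a set \<Rightarrow> 'a set set \<Rightarrow> enat" where
  "gamma_si V H =
     (if has_isolated_vertex V H then \<infinity>
      else Max (domination_number V H ` {A. strongly_independent V H A}))"

definition gamma_E :: "'a set \<Rightarrow> 'a set set \<Rightarrow> enat" where
  "gamma_E V H =
     (if has_isolated_vertex V H then \<infinity>
      else (INF F \<in> {F. F \<subseteq> H \<and> dominates H (\<Union>F) V}. enat (card F)))"

definition ceil_half :: "enat \<Rightarrow> enat" where
  "ceil_half n = (case n of enat m \<Rightarrow> enat (nat \<lceil>real m / 2\<rceil>) | \<infinity> \<Rightarrow> \<infinity>)"

end

theory Submission
  imports Defs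
begin

text \<open>
  Let \<open>e\<close> be an inclusion-minimal edge of \<open>H\<close>, and let \<open>H/e\<close> be the hypergraph on \<open>V - e\<close> whose
  edges are the sets \<open>f - e\<close> with \<open>f \<noteq> e\<close> in \<open>H\<close>. The faces of \<open>I(H - e)\<close> missing from \<open>I(H)\<close> are
  those containing \<open>e\<close>, and the link of \<open>e\<close> in \<open>I(H - e)\<close> is \<open>I(H/e)\<close>, so the exact sequence of the
  pair gives
  \<open>\<eta>(I(H)) \<ge> min {\<eta>(I(H - e)), \<eta>(I(H/e)) + |e| - 1}\<close>.
  An edge that is not minimal can be deleted without changing \<open>I(H)\<close>, and an isolated vertex makes
  \<open>I(H)\<close> a cone. Deleting an edge decreases none of the three domination parameters, and, for a suitable
  choice of \<open>e\<close>, contracting it decreases the bound by at most \<open>|e| - 1\<close>. All three inequalities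
  follow by induction on the number of edges.
\<close>

section \<open>Chains over the two-element field\<close>

lemma bit_add_self [simp]: "x + x = (0::bit)"
  by (cases x) auto

declare add_bit_eq_xor [simp del]

text \<open>Faces of \<open>K\<close> covering \<open>\<tau>\<close> correspond to the vertex added,
  and summands off \<open>K\<close> vanish. The right-hand side does not mention \<open>K\<close>,
  so a chain has the same boundary in every complex on \<open>V\<close> that carries it.\<close>

lemma chain_boundary_eq_sum:
  assumes "finite V" "K \<subseteq> Pow V" "\<And>\<sigma>. \<sigma> \<notin> K \<Longrightarrow> c \<sigma> = 0"
  shows "chain_boundary K c \<tau> = (\<Sum>v\<in>V - \<tau>. c (insert v \<tau>))"
proof -
  let ?S = "{v \<in> V - \<tau>. insert v \<tau> \<in> K}"
  have "{\<sigma> \<in> K. \<exists>v. v \<notin> \<tau> \<and> \<sigma> = insert v \<tau>} = (\<lambda>v. insert v \<tau>) ` ?S"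
    using assms(2) by auto
  moreover have "inj_on (\<lambda>v. insert v \<tau>) ?S"
    by (auto simp: inj_on_def)
  ultimately have "chain_boundary K c \<tau> = (\<Sum>v\<in>?S. c (insert v \<tau>))"
    unfolding chain_boundary_def by (simp add: sum.reindex)
  also have "\<dots> = (\<Sum>v\<in>V - \<tau>. c (insert v \<tau>))"
    using assms(1,3) by (intro sum.mono_neutral_left) auto
  finally show ?thesis .
qed

lemma chains_eq_0: "c \<in> chains K i \<Longrightarrow> \<sigma> \<notin> K \<Longrightarrow> c \<sigma> = 0"
  by (auto simp: chains_def)

lemma chain_boundary_chains:
  assumes "finite V" "K \<subseteq> Pow V" "c \<in> chains K i"
  shows "chain_boundary K c \<tau> = (\<Sum>v\<in>V - \<tau>. c (insert v \<tau>))"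
  using chain_boundary_eq_sum assms chains_eq_0 by metis

lemma chains_add: "c \<in> chains K i \<Longrightarrow> d \<in> chains K i \<Longrightarrow> (\<lambda>\<sigma>. c \<sigma> + d \<sigma>) \<in> chains K i"
  unfolding chains_def mem_Collect_eq by (metis add_0)

lemma chain_boundary_add:
  "chain_boundary K (\<lambda>\<sigma>. c \<sigma> + d \<sigma>) = (\<lambda>\<tau>. chain_boundary K c \<tau> + chain_boundary K d \<tau>)"
  by (simp add: chain_boundary_def sum.distrib fun_eq_iff)

lemma cycles_zero: "(\<lambda>_. 0) \<in> cycles K i"
  by (simp add: cycles_def chains_def chain_boundary_def fun_eq_iff)

lemma cycles_add: "c \<in> cycles K i \<Longrightarrow> d \<in> cycles K i \<Longrightarrow> (\<lambda>\<sigma>. c \<sigma> + d \<sigma>) \<in> cycles K i"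
  by (simp add: cycles_def chains_add chain_boundary_add fun_eq_iff)

text \<open>Each unordered pair is counted twice and cancels modulo 2. This is why a boundary has
  zero boundary: two vertices can be added to a face in either order.\<close>

lemma sum_symmetric_pairs_eq_0:
  assumes "finite S" "\<And>v w. f v w = f w v"
  shows "(\<Sum>v\<in>S. \<Sum>w\<in>S - {v}. f v w) = (0::bit)"
  using assms(1)
proof (induction S)
  case (insert x S)
  have "(\<Sum>v\<in>S. \<Sum>w\<in>insert x S - {v}. f v w) = (\<Sum>v\<in>S. f v x + (\<Sum>w\<in>S - {v}. f v w))"
  proof (rule sum.cong)
    fix v assume "v \<in> S"
    then have "insert x S - {v} = insert x (S - {v})" using insert by auto
    then show "(\<Sum>w\<in>insert x S - {v}. f v w) = f v x + (\<Sum>w\<in>S - {v}. f v w)"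
      using insert by simp
  qed simp
  also have "\<dots> = (\<Sum>v\<in>S. f x v)"
    using insert.IH assms(2)[of _ x] by (simp add: sum.distrib)
  moreover have "insert x S - {x} = S" using insert by auto
  ultimately show ?case using insert by simp
qed simp

lemma boundary_boundary:
  assumes "finite V"
  shows "(\<Sum>v\<in>V - \<tau>. \<Sum>w\<in>V - insert v \<tau>. c (insert w (insert v \<tau>))) = (0::bit)"
proof -
  have "V - insert v \<tau> = V - \<tau> - {v}" for v by auto
  then show ?thesis
    using sum_symmetric_pairs_eq_0[of "V - \<tau>" "\<lambda>v w. c (insert w (insert v \<tau>))"] assms
    by (simp add: insert_commute)
qed

section \<open>Cycles, boundaries and \<open>eta\<close>\<close>

definition simplicial_complex :: "'a set \<Rightarrow> 'a set set \<Rightarrow> bool" where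
  "simplicial_complex V K \<longleftrightarrow> finite V \<and> K \<subseteq> Pow V \<and> (\<forall>\<sigma>\<in>K. \<forall>\<tau>. \<tau> \<subseteq> \<sigma> \<longrightarrow> \<tau> \<in> K)"

lemma boundary_in_chains:
  assumes "simplicial_complex V K" "c \<in> chains K (i + 1)"
  shows "chain_boundary K c \<in> chains K i"
  unfolding chains_def
proof (intro CollectI allI impI)
  fix \<tau> assume "chain_boundary K c \<tau> \<noteq> 0"
  then obtain v where v: "v \<notin> \<tau>" "insert v \<tau> \<in> K" "c (insert v \<tau>) \<noteq> 0"
    unfolding chain_boundary_def using sum.not_neutral_contains_not_neutral by blast
  then have "int (card (insert v \<tau>)) = i + 2" using assms(2) by (auto simp: chains_def)
  moreover have "finite \<tau>"
    using v(2) assms(1) by (auto simp: simplicial_complex_def intro: finite_subset)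
  ultimately show "\<tau> \<in> K \<and> int (card \<tau>) = i + 1"
    using v assms(1) by (auto simp: simplicial_complex_def)
qed

lemma boundaries_subset_cycles:
  assumes "simplicial_complex V K"
  shows "boundaries K i \<subseteq> cycles K i"
proof
  fix b assume "b \<in> boundaries K i"
  then obtain c where c: "c \<in> chains K (i + 1)" "b = chain_boundary K c"
    by (auto simp: boundaries_def)
  have V: "finite V" "K \<subseteq> Pow V" using assms by (auto simp: simplicial_complex_def)
  have b: "b \<in> chains K i" using boundary_in_chains assms c by blast
  have "chain_boundary K b \<tau> = 0" for \<tau>
    unfolding chain_boundary_chains[OF V b]
    unfolding c(2) chain_boundary_chains[OF V c(1)] by (rule boundary_boundary[OF V(1)])
  then show "b \<in> cycles K i" using b by (simp add: cycles_def fun_eq_iff)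
qed

text \<open>Vanishing homology phrased without quotient groups. No lower bound on \<open>i\<close>
  is imposed: the inclusion is automatic below -1, so degrees shifted by the size of an edge require
  no case distinction.\<close>

definition acyclic_upto :: "int \<Rightarrow> 'a set set \<Rightarrow> bool" where
  "acyclic_upto k K \<longleftrightarrow> (\<forall>i\<le>k. cycles K i \<subseteq> boundaries K i)"

lemma cycles_subset_boundaries_below:
  assumes "i < -1"
  shows "cycles K i \<subseteq> boundaries K i"
proof
  fix c assume "c \<in> cycles K i"
  then have "c = (\<lambda>_. 0)" using assms by (auto simp: cycles_def chains_def fun_eq_iff)
  moreover have "chain_boundary K (\<lambda>_. 0) = (\<lambda>_. 0)" by (simp add: chain_boundary_def fun_eq_iff)
  ultimately show "c \<in> boundaries K i" by (force simp: boundaries_def chains_def)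
qed

lemma acyclic_upto_below: "k < -1 \<Longrightarrow> acyclic_upto k K"
  unfolding acyclic_upto_def using cycles_subset_boundaries_below by (meson le_less_trans)

lemma comm_group_cycle_group: "comm_group (cycle_group K i)"
proof (rule comm_groupI)
  fix c assume "c \<in> carrier (cycle_group K i)"
  \<comment> \<open>Each cycle is its own inverse.\<close>
  then show "\<exists>d\<in>carrier (cycle_group K i). d \<otimes>\<^bsub>cycle_group K i\<^esub> c = \<one>\<^bsub>cycle_group K i\<^esub>"
    by (auto simp: cycle_group_def fun_eq_iff intro!: bexI[of _ c])
qed (auto simp: cycle_group_def cycles_add cycles_zero fun_eq_iff add_ac)

text \<open>When every cycle bounds, the quotient is by the whole cycle group and has a single
  coset.\<close>

lemma trivial_reduced_homology:
  assumes "simplicial_complex V K" "cycles K i \<subseteq> boundaries K i"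
  shows "trivial_group (reduced_homology K i)"
proof -
  interpret comm_group "cycle_group K i" by (rule comm_group_cycle_group)
  have eq: "boundaries K i = carrier (cycle_group K i)"
    using assms boundaries_subset_cycles[OF assms(1), of i] by (auto simp: cycle_group_def)
  have "normal (carrier (cycle_group K i)) (cycle_group K i)"
    using subgroup_imp_normal subgroup_self by blast
  then interpret N: normal "carrier (cycle_group K i)" "cycle_group K i" .
  have "carrier (reduced_homology K i) \<subseteq> {carrier (cycle_group K i)}"
    using coset_join2[OF _ subgroup_self]
    by (auto simp: reduced_homology_def eq FactGroup_def RCOSETS_def)
  moreover have "group (reduced_homology K i)"
    using N.factorgroup_is_group by (simp add: reduced_homology_def eq)
  ultimately show ?thesis using group.trivial_group_alt by blast
qed

lemma homologically_connectedI:
  assumes "simplicial_complex V K" "acyclic_upto k K"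
  shows "homologically_connected k K"
  using assms trivial_reduced_homology unfolding homologically_connected_def acyclic_upto_def by blast

lemma homologically_connected_le_eta:
  assumes "homologically_connected (int n - 2) K"
  shows "enat n \<le> eta K"
proof (cases "\<exists>k. homologically_connected (k - 2) K \<and> (\<forall>j. homologically_connected (j - 2) K \<longrightarrow> j \<le> k)")
  case True
  then obtain k where k: "homologically_connected (k - 2) K"
      "\<forall>j. homologically_connected (j - 2) K \<longrightarrow> j \<le> k" by blast
  then have "(GREATEST k. homologically_connected (k - 2) K) = k" by (intro Greatest_equality) auto
  moreover have "int n \<le> k" using assms k by auto
  ultimately show ?thesis using True by (simp add: eta_def)
qed (auto simp: eta_def)

section \<open>Cones and links\<close>

text \<open>A cycle \<open>z\<close> is filled by the cone \<open>c\<close> with apex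
  \<open>v\<close> over the part of \<open>z\<close> that avoids \<open>v\<close>.\<close>

lemma acyclic_cone:
  assumes "finite V" "K \<subseteq> Pow V" "v \<in> V" "\<And>\<sigma>. \<sigma> \<in> K \<Longrightarrow> insert v \<sigma> \<in> K"
  shows "acyclic_upto k K"
proof -
  have "z \<in> boundaries K i" if z: "z \<in> cycles K i" for z i
  proof -
    define c where "c \<sigma> = (if v \<in> \<sigma> then z (\<sigma> - {v}) else 0)" for \<sigma>
    have zc: "z \<in> chains K i" and dz: "chain_boundary K z = (\<lambda>_. 0)"
      using z by (auto simp: cycles_def)
    have cc: "c \<in> chains K (i + 1)"
      unfolding chains_def
    proof (intro CollectI allI impI)
      fix \<sigma> assume "c \<sigma> \<noteq> 0"
      then have \<sigma>: "v \<in> \<sigma>" "z (\<sigma> - {v}) \<noteq> 0" by (auto simp: c_def split: if_splits)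
      then have *: "\<sigma> - {v} \<in> K" "int (card (\<sigma> - {v})) = i + 1" using zc by (auto simp: chains_def)
      then have "\<sigma> - {v} \<subseteq> V" using assms(2) by blast
      then have "finite (\<sigma> - {v})" using assms(1) by (rule finite_subset)
      then have "card \<sigma> = Suc (card (\<sigma> - {v}))" using \<sigma>(1) card.remove[of \<sigma> v] by simp
      then show "\<sigma> \<in> K \<and> int (card \<sigma>) = i + 1 + 1"
        using * assms(4)[OF *(1)] \<sigma>(1) by (simp add: insert_absorb)
    qed
    have "chain_boundary K c \<tau> = z \<tau>" for \<tau>
    proof (cases "v \<in> \<tau>")
      case True
      \<comment> \<open>The boundary of \<open>z\<close> vanishes at \<open>\<tau> - {v}\<close>.
        Its summand adding \<open>v\<close> back is \<open>z \<tau>\<close>, so the remaining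
        summands, which form the boundary of \<open>c\<close> at \<open>\<tau>\<close>, also sum to
        \<open>z \<tau>\<close> modulo 2.\<close>
      have "V - (\<tau> - {v}) = insert v (V - \<tau>)" using True assms(3) by auto
      moreover have "chain_boundary K z (\<tau> - {v}) = 0" by (simp add: dz)
      ultimately have "z \<tau> + (\<Sum>w\<in>V - \<tau>. z (insert w (\<tau> - {v}))) = 0"
        using True assms(1) by (simp add: chain_boundary_chains[OF assms(1,2) zc] insert_absorb)
      moreover have "c (insert w \<tau>) = z (insert w (\<tau> - {v}))" if "w \<in> V - \<tau>" for w
      proof -
        have "insert w \<tau> - {v} = insert w (\<tau> - {v})" using that True by auto
        then show ?thesis using True by (simp add: c_def)
      qed
      ultimately show ?thesis
        by (cases "z \<tau>"; cases "\<Sum>w\<in>V - \<tau>. z (insert w (\<tau> - {v}))")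
          (simp_all add: chain_boundary_chains[OF assms(1,2) cc])
    next
      case False
      then have "c (insert w \<tau>) = (if w = v then z \<tau> else 0)" for w by (auto simp: c_def)
      then show ?thesis
        using False assms(1,3) by (simp add: chain_boundary_chains[OF assms(1,2) cc] sum.delta)
    qed
    then have "z = chain_boundary K c" by auto
    then show ?thesis using cc by (auto simp: boundaries_def)
  qed
  then show ?thesis by (auto simp: acyclic_upto_def)
qed

text \<open>
  The exact sequence of a pair at chain level: a cycle that bounds after adding the faces containing
  \<open>e\<close> bounds a chain whose coefficients at those faces form a cycle in the link of \<open>e\<close>; a filling of
  the latter corrects the chain.
\<close>

lemma cycles_subset_boundaries_link:
  assumes K: "simplicial_complex V K" and e: "e \<subseteq> V"
    and del: "cycles K i \<subseteq> boundaries K i"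
    and link: "cycles {\<tau>. \<tau> \<inter> e = {} \<and> \<tau> \<union> e \<in> K} (i + 1 - int (card e))
      \<subseteq> boundaries {\<tau>. \<tau> \<inter> e = {} \<and> \<tau> \<union> e \<in> K} (i + 1 - int (card e))"
  shows "cycles {\<sigma>\<in>K. \<not> e \<subseteq> \<sigma>} i \<subseteq> boundaries {\<sigma>\<in>K. \<not> e \<subseteq> \<sigma>} i"
proof
  let ?K0 = "{\<sigma>\<in>K. \<not> e \<subseteq> \<sigma>}" and ?L = "{\<tau>. \<tau> \<inter> e = {} \<and> \<tau> \<union> e \<in> K}"
  fix z assume z: "z \<in> cycles ?K0 i"
  have V: "finite V" "K \<subseteq> Pow V" and V0: "?K0 \<subseteq> Pow V" and VL: "?L \<subseteq> Pow V"
    using K by (auto simp: simplicial_complex_def)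
  have fin: "finite \<sigma>" if "\<sigma> \<in> K" for \<sigma> using that V by (blast intro: finite_subset)
  have fe: "finite e" using e V(1) by (rule finite_subset)
  have z0: "z \<in> chains ?K0 i" and dz: "chain_boundary ?K0 z = (\<lambda>_. 0)"
    using z by (auto simp: cycles_def)
  have zK: "z \<in> chains K i" using z0 by (auto simp: chains_def)
  have "chain_boundary K z = (\<lambda>_. 0)"
    using dz by (simp add: fun_eq_iff chain_boundary_chains[OF V zK] chain_boundary_chains[OF V(1) V0 z0])
  then have "z \<in> boundaries K i" using del zK by (auto simp: cycles_def)
  then obtain c where c: "c \<in> chains K (i + 1)" "z = chain_boundary K c"
    by (auto simp: boundaries_def)
  have dc: "(\<Sum>v\<in>V - \<tau>. c (insert v \<tau>)) = z \<tau>" for \<tau>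
    using c chain_boundary_chains[OF V c(1)] by simp
  \<comment> \<open>The coefficients of \<open>c\<close> at faces containing \<open>e\<close>, read
    in the link. Removing \<open>e\<close> lowers the dimension from \<open>i + 1\<close> to
    \<open>i + 1 - int (card e)\<close>.\<close>
  define d where "d \<tau> = (if \<tau> \<inter> e = {} then c (\<tau> \<union> e) else 0)" for \<tau>
  have d: "d \<in> chains ?L (i + 1 - int (card e))"
    unfolding chains_def
  proof (intro CollectI allI impI)
    fix \<tau> assume "d \<tau> \<noteq> 0"
    then have \<tau>: "\<tau> \<inter> e = {}" "c (\<tau> \<union> e) \<noteq> 0" by (auto simp: d_def split: if_splits)
    then have *: "\<tau> \<union> e \<in> K" "int (card (\<tau> \<union> e)) = i + 2" using c by (auto simp: chains_def)
    then have "finite \<tau>" using fin by blast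
    then show "\<tau> \<in> ?L \<and> int (card \<tau>) = i + 1 - int (card e) + 1"
      using * \<tau> fe by (simp add: card_Un_disjoint)
  qed
  have "chain_boundary ?L d \<tau> = 0" for \<tau>
  proof (cases "\<tau> \<inter> e = {}")
    case True
    \<comment> \<open>Summands with \<open>v\<close> in \<open>e\<close> vanish, so this is the
      boundary of \<open>c\<close> at \<open>\<tau> \<union> e\<close>. That is
      \<open>z (\<tau> \<union> e)\<close>, which is zero because \<open>z\<close> is supported on
      faces not containing \<open>e\<close>.\<close>
    have "(\<Sum>v\<in>V - \<tau>. d (insert v \<tau>)) = (\<Sum>v\<in>V - (\<tau> \<union> e). c (insert v (\<tau> \<union> e)))"
      using V(1) True by (intro sum.mono_neutral_cong_right) (auto simp: d_def)
    also have "\<dots> = z (\<tau> \<union> e)" by (rule dc)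
    also have "\<dots> = 0" using z0 by (auto intro: chains_eq_0)
    finally show ?thesis by (simp add: chain_boundary_chains[OF V(1) VL d])
  next
    case False
    then show ?thesis
      by (auto simp: chain_boundary_chains[OF V(1) VL d] d_def intro!: sum.neutral)
  qed
  then have "d \<in> cycles ?L (i + 1 - int (card e))" using d by (simp add: cycles_def fun_eq_iff)
  then obtain g where g: "g \<in> chains ?L (i + 1 - int (card e) + 1)" "d = chain_boundary ?L g"
    using link by (auto simp: boundaries_def)
  have dg: "(\<Sum>v\<in>V - \<tau>. g (insert v \<tau>)) = d \<tau>" for \<tau>
    using g chain_boundary_chains[OF V(1) VL g(1)] by simp
  \<comment> \<open>The join of \<open>g\<close> with \<open>e\<close>; its boundary agrees with
    \<open>c\<close> at the faces containing \<open>e\<close>.\<close>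
  define g' where "g' \<sigma> = (if e \<subseteq> \<sigma> then g (\<sigma> - e) else 0)" for \<sigma>
  have g': "g' \<in> chains K (i + 1 + 1)"
    unfolding chains_def
  proof (intro CollectI allI impI)
    fix \<sigma> assume "g' \<sigma> \<noteq> 0"
    then have \<sigma>: "e \<subseteq> \<sigma>" "g (\<sigma> - e) \<noteq> 0" by (auto simp: g'_def split: if_splits)
    then have *: "\<sigma> - e \<in> ?L" "int (card (\<sigma> - e)) = i + 1 - int (card e) + 1 + 1"
      using g by (auto simp: chains_def)
    moreover have "\<sigma> - e \<union> e = \<sigma>" using \<sigma> by auto
    ultimately have "\<sigma> \<in> K" by simp
    then show "\<sigma> \<in> K \<and> int (card \<sigma>) = i + 1 + 1 + 1"
      using * \<sigma> fin[of \<sigma>] fe by (simp add: card_Diff_subset card_mono of_nat_diff)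
  qed
  \<comment> \<open>Adding a boundary keeps the boundary of \<open>c\<close> and cancels its
    coefficients at the faces containing \<open>e\<close>.\<close>
  define c' where "c' \<sigma> = c \<sigma> + chain_boundary K g' \<sigma>" for \<sigma>
  have c'K: "c' \<in> chains K (i + 1)"
    unfolding c'_def using c(1) boundary_in_chains[OF K g'] by (rule chains_add)
  have c'0: "c' \<sigma> = 0" if \<sigma>: "e \<subseteq> \<sigma>" for \<sigma>
  proof -
    have "(\<Sum>v\<in>V - \<sigma>. g' (insert v \<sigma>)) = (\<Sum>v\<in>V - (\<sigma> - e). g (insert v (\<sigma> - e)))"
    proof (rule sum.mono_neutral_cong_left)
      \<comment> \<open>The extra vertices \<open>v\<close> lie in \<open>e\<close>, and no face of
        the link meets \<open>e\<close>.\<close>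
      show "\<forall>v\<in>V - (\<sigma> - e) - (V - \<sigma>). g (insert v (\<sigma> - e)) = 0"
        using g(1) by (auto intro!: chains_eq_0)
      show "g' (insert v \<sigma>) = g (insert v (\<sigma> - e))" if "v \<in> V - \<sigma>" for v
      proof -
        have "insert v \<sigma> - e = insert v (\<sigma> - e)" using that \<sigma> by auto
        then show ?thesis using \<sigma> by (auto simp: g'_def)
      qed
    qed (use V(1) in auto)
    also have "\<dots> = d (\<sigma> - e)" by (rule dg)
    also have "\<dots> = c \<sigma>"
    proof -
      have "\<sigma> - e \<union> e = \<sigma>" using \<sigma> by auto
      then show ?thesis by (simp add: d_def Int_commute)
    qed
    finally show ?thesis by (simp add: c'_def chain_boundary_chains[OF V g'])
  qed
  have c': "c' \<in> chains ?K0 (i + 1)"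
    unfolding chains_def
  proof (intro CollectI allI impI)
    fix \<sigma> assume "c' \<sigma> \<noteq> 0"
    then show "\<sigma> \<in> ?K0 \<and> int (card \<sigma>) = i + 1 + 1"
      using c'K c'0 by (auto simp: chains_def)
  qed
  have "chain_boundary ?K0 c' \<tau> = z \<tau>" for \<tau>
  proof -
    have "chain_boundary ?K0 c' \<tau> = chain_boundary K c' \<tau>"
      by (simp add: chain_boundary_chains[OF V(1) V0 c'] chain_boundary_chains[OF V c'K])
    also have "\<dots> = z \<tau> + chain_boundary K (chain_boundary K g') \<tau>"
      unfolding c'_def chain_boundary_add c(2) ..
    also have "chain_boundary K g' \<in> cycles K (i + 1)"
      using boundaries_subset_cycles[OF K] g' unfolding boundaries_def by blast
    then have "chain_boundary K (chain_boundary K g') \<tau> = 0" by (simp add: cycles_def)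
    finally show ?thesis by simp
  qed
  then have "z = chain_boundary ?K0 c'" by auto
  then show "z \<in> boundaries ?K0 i" using c' by (auto simp: boundaries_def)
qed

section \<open>Deletion and contraction of edges\<close>

definition contract :: "'a set set \<Rightarrow> 'a set \<Rightarrow> 'a set set" where
  "contract H e = (\<lambda>f. f - e) ` (H - {e})"

lemma finite_edges: "hypergraph V H \<Longrightarrow> finite H"
  by (auto simp: hypergraph_def intro: finite_subset[of _ "Pow V"])

lemma finite_edge: "hypergraph V H \<Longrightarrow> e \<in> H \<Longrightarrow> finite e"
  by (auto simp: hypergraph_def intro: finite_subset)

lemma hypergraph_delete: "hypergraph V H \<Longrightarrow> hypergraph V (H - {e})"
  by (auto simp: hypergraph_def)

text \<open>Minimality of \<open>e\<close> keeps every \<open>f - e\<close> nonempty.\<close>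

lemma hypergraph_contract:
  assumes "hypergraph V H" "\<forall>f\<in>H. f \<subseteq> e \<longrightarrow> f = e"
  shows "hypergraph (V - e) (contract H e)"
  using assms unfolding hypergraph_def contract_def by blast

lemma simplicial_complex_independence:
  "hypergraph V H \<Longrightarrow> simplicial_complex V (independence_complex V H)"
  by (fastforce simp: simplicial_complex_def hypergraph_def independence_complex_def independent_def)

lemma acyclic_edge_step:
  assumes H: "hypergraph V H" "e \<in> H" and min: "\<forall>f\<in>H. f \<subseteq> e \<longrightarrow> f = e"
    and del: "acyclic_upto k (independence_complex V (H - {e}))"
    and con: "acyclic_upto (k + 1 - int (card e)) (independence_complex (V - e) (contract H e))"
  shows "acyclic_upto k (independence_complex V H)"
  unfolding acyclic_upto_def
proof (intro allI impI)
  fix i assume "i \<le> k"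
  let ?K = "independence_complex V (H - {e})"
  have e: "e \<subseteq> V" using H by (auto simp: hypergraph_def)
  \<comment> \<open>For \<open>\<tau>\<close> disjoint from \<open>e\<close>, an edge
    \<open>f\<close> lies in \<open>\<tau> \<union> e\<close> iff \<open>f - e\<close> lies in
    \<open>\<tau>\<close>.\<close>
  have L: "{\<tau>. \<tau> \<inter> e = {} \<and> \<tau> \<union> e \<in> ?K} = independence_complex (V - e) (contract H e)"
    using e by (auto simp: independence_complex_def independent_def contract_def)
  have K: "{\<sigma>\<in>?K. \<not> e \<subseteq> \<sigma>} = independence_complex V H"
    using H(2) by (auto simp: independence_complex_def independent_def)
  have "simplicial_complex V ?K"
    using H(1) by (intro simplicial_complex_independence hypergraph_delete)
  from cycles_subset_boundaries_link[OF this e, of i]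
  show "cycles (independence_complex V H) i \<subseteq> boundaries (independence_complex V H) i"
    unfolding L K using del con \<open>i \<le> k\<close> by (simp add: acyclic_upto_def)
qed

lemma acyclic_isolated:
  assumes "hypergraph V H" "has_isolated_vertex V H"
  shows "acyclic_upto k (independence_complex V H)"
proof -
  obtain v where v: "v \<in> V" "\<forall>e\<in>H. v \<notin> e" using assms by (auto simp: has_isolated_vertex_def)
  show ?thesis
  proof (rule acyclic_cone[of V _ v])
    fix \<sigma> assume "\<sigma> \<in> independence_complex V H"
    then show "insert v \<sigma> \<in> independence_complex V H"
      using v by (auto simp: independence_complex_def independent_def subset_insert)
  qed (use assms v in \<open>auto simp: hypergraph_def independence_complex_def independent_def\<close>)
qed

text \<open>\<open>P V H m\<close> stands for a domination parameter being at least
  \<open>m\<close>, so that the three bounds share one induction. \<open>V\<close> and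
  \<open>m\<close> are generalized because contraction changes them. As \<open>step\<close> must
  produce an edge, it forces \<open>P\<close> to fail for positive \<open>m\<close> when
  \<open>V\<close> and \<open>H\<close> are empty, where the complex is \<open>{{}}\<close>.\<close>

lemma acyclic_edge_induct:
  fixes P :: "'a set \<Rightarrow> 'a set set \<Rightarrow> int \<Rightarrow> bool"
  assumes step: "\<And>V H m. hypergraph V H \<Longrightarrow> P V H m \<Longrightarrow> m > 0 \<Longrightarrow> \<not> has_isolated_vertex V H \<Longrightarrow>
      \<exists>e\<in>H. P V (H - {e}) m \<and>
        ((\<forall>f\<in>H. f \<subseteq> e \<longrightarrow> f = e) \<longrightarrow> P (V - e) (contract H e) (m + 1 - int (card e)))"
    and "hypergraph V H" "P V H m"
  shows "acyclic_upto (m - 2) (independence_complex V H)"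
  using assms(2,3)
proof (induction "card H" arbitrary: V H m rule: less_induct)
  case less
  consider "m \<le> 0" | "has_isolated_vertex V H" | "m > 0" "\<not> has_isolated_vertex V H" by linarith
  then show ?case
  proof cases
    case 1
    then show ?thesis by (simp add: acyclic_upto_below)
  next
    case 2
    then show ?thesis using less.prems acyclic_isolated by blast
  next
    case 3
    then obtain e where e: "e \<in> H" "P V (H - {e}) m"
        "(\<forall>f\<in>H. f \<subseteq> e \<longrightarrow> f = e) \<Longrightarrow> P (V - e) (contract H e) (m + 1 - int (card e))"
      using step[OF less.prems 3] by blast
    have fin: "finite H" using less.prems finite_edges by blast
    have card: "card (H - {e}) < card H" using fin e(1) by (rule card_Diff1_less)
    have del: "acyclic_upto (m - 2) (independence_complex V (H - {e}))"
      using less.hyps[OF card] hypergraph_delete less.prems e by blast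
    show ?thesis
    proof (cases "\<forall>f\<in>H. f \<subseteq> e \<longrightarrow> f = e")
      case True
      \<comment> \<open>Contraction may merge edges, and \<open>e\<close> itself disappears, so the
        number of edges drops.\<close>
      have "card (contract H e) < card H"
        unfolding contract_def using card card_image_le[of "H - {e}" "\<lambda>f. f - e"] fin by simp
      then have "acyclic_upto (m + 1 - int (card e) - 2) (independence_complex (V - e) (contract H e))"
        using less.hyps hypergraph_contract less.prems e True by blast
      then show ?thesis
        using acyclic_edge_step[OF less.prems(1) e(1) True del] by (simp add: algebra_simps)
    next
      case False
      then obtain f where "f \<in> H" "f \<subseteq> e" "f \<noteq> e" by blast
      then have "independence_complex V H = independence_complex V (H - {e})"
        unfolding independence_complex_def independent_def by blast
      then show ?thesis using del by simp
    qed
  qed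
qed

section \<open>Domination\<close>

lemma dominates_vertex_iff:
  "dominates_vertex H W v \<longleftrightarrow> (\<exists>f\<in>H. v \<in> f \<and> f \<subseteq> insert v W)"
proof
  assume "\<exists>f\<in>H. v \<in> f \<and> f \<subseteq> insert v W"
  then obtain f where f: "f \<in> H" "v \<in> f" "f \<subseteq> insert v W" by blast
  then have "f - {v} \<subseteq> W - {v}" "f - {v} \<union> {v} \<in> H" by (auto simp: insert_absorb)
  then show "dominates_vertex H W v" unfolding dominates_vertex_def by blast
qed (auto simp: dominates_vertex_def)

text \<open>Used for deletions: whatever dominates in \<open>H - {e}\<close> dominates in
  \<open>H\<close>.\<close>

lemma dominates_mono:
  "dominates H W A \<Longrightarrow> H \<subseteq> H' \<Longrightarrow> W \<subseteq> W' \<Longrightarrow> dominates H' W' A"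
  unfolding dominates_def dominates_vertex_iff by (meson insert_mono order_trans subsetD)

text \<open>A vertex of \<open>e\<close> is dominated through \<open>e\<close> itself, any other
  vertex through an edge \<open>f\<close> of \<open>H\<close> behind the contracted edge
  \<open>f - e\<close>.\<close>

lemma dominates_contract:
  assumes "e \<in> H" "dominates (contract H e) W (V - e)"
  shows "dominates H (W \<union> e) V"
  unfolding dominates_def
proof
  fix v assume "v \<in> V"
  show "dominates_vertex H (W \<union> e) v"
  proof (cases "v \<in> e")
    case True
    then show ?thesis using assms(1) by (auto simp: dominates_vertex_iff)
  next
    case False
    then have "dominates_vertex (contract H e) W v"
      using assms(2) \<open>v \<in> V\<close> by (auto simp: dominates_def)
    then show ?thesis by (auto simp: dominates_vertex_iff contract_def)
  qed
qed

text \<open>Supplies the edge to contract. If all edges are loops, every vertex is a loop for lack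
  of isolated ones, and the empty set dominates \<open>V\<close>.\<close>

lemma large_edge_cases:
  assumes "hypergraph V H" "\<not> has_isolated_vertex V H"
  obtains "dominates H {} V" | e where "e \<in> H" "2 \<le> card e"
proof (cases "\<exists>e\<in>H. 2 \<le> card e")
  case False
  have "dominates_vertex H {} v" if "v \<in> V" for v
  proof -
    obtain e where e: "e \<in> H" "v \<in> e" using \<open>v \<in> V\<close> assms(2) unfolding has_isolated_vertex_def by blast
    then have "card e \<le> Suc 0" using False by force
    then have "e \<subseteq> {v}" using e finite_edge[OF assms(1)] by (auto simp: card_le_Suc0_iff_eq)
    then show ?thesis using e by (auto simp: dominates_vertex_iff)
  qed
  then show ?thesis using that by (auto simp: dominates_def)
qed (use that in blast)

section \<open>The three domination bounds\<close>

text \<open>The hypothesis says that \<open>m\<close> is at most half of \<open>card W\<close>,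
  rounded up. Lifting \<open>W\<close> from the contraction adds at most \<open>card e\<close>
  vertices while \<open>m\<close> drops by \<open>card e - 1\<close>; twice this drop is at least
  \<open>card e\<close> once \<open>e\<close> has two vertices.\<close>

lemma acyclic_total_domination:
  assumes "hypergraph V H" "\<And>W. W \<subseteq> V \<Longrightarrow> dominates H W V \<Longrightarrow> 2 * m \<le> int (card W) + 1"
  shows "acyclic_upto (m - 2) (independence_complex V H)"
proof (rule acyclic_edge_induct
    [where P = "\<lambda>V H m. \<forall>W\<subseteq>V. dominates H W V \<longrightarrow> 2 * m \<le> int (card W) + 1"])
  fix V :: "'a set" and H and m :: int
  assume H: "hypergraph V H" and "m > 0" and iso: "\<not> has_isolated_vertex V H"
    and bound: "\<forall>W\<subseteq>V. dominates H W V \<longrightarrow> 2 * m \<le> int (card W) + 1"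
  \<comment> \<open>The empty set would give \<open>2 * m \<le> 1\<close>.\<close>
  have "\<not> dominates H {} V" using bound \<open>m > 0\<close> by force
  then obtain e where e: "e \<in> H" "2 \<le> card e" using large_edge_cases[OF H iso] by blast
  have "2 * (m + 1 - int (card e)) \<le> int (card W) + 1"
    if W: "W \<subseteq> V - e" "dominates (contract H e) W (V - e)" for W
  proof -
    have "dominates H (W \<union> e) V" using dominates_contract e(1) W(2) by blast
    moreover have "W \<union> e \<subseteq> V" using W e H by (auto simp: hypergraph_def)
    ultimately have "2 * m \<le> int (card (W \<union> e)) + 1" using bound by blast
    moreover have "int (card (W \<union> e)) \<le> int (card W) + int (card e)" "2 \<le> int (card e)"
      using card_Un_le[of W e] e(2) by linarith+
    ultimately show ?thesis by (simp add: algebra_simps)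
  qed
  moreover have "2 * m \<le> int (card W) + 1" if "W \<subseteq> V" "dominates (H - {e}) W V" for W
    using that bound dominates_mono[of "H - {e}" W V H W] by blast
  ultimately show "\<exists>e\<in>H. (\<forall>W\<subseteq>V. dominates (H - {e}) W V \<longrightarrow> 2 * m \<le> int (card W) + 1) \<and>
      ((\<forall>f\<in>H. f \<subseteq> e \<longrightarrow> f = e) \<longrightarrow>
        (\<forall>W\<subseteq>V - e. dominates (contract H e) W (V - e) \<longrightarrow> 2 * (m + 1 - int (card e)) \<le> int (card W) + 1))"
    by (intro bexI[OF _ e(1)] conjI impI allI) blast+
qed (use assms in auto)

text \<open>Lifting a family from the contraction costs one more edge, \<open>e\<close> itself,
  while \<open>m\<close> drops by \<open>card e - 1\<close>, which is at least 1 for an edge with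
  two vertices.\<close>

lemma acyclic_edge_domination:
  assumes "hypergraph V H" "\<And>F. F \<subseteq> H \<Longrightarrow> dominates H (\<Union>F) V \<Longrightarrow> m \<le> int (card F)"
  shows "acyclic_upto (m - 2) (independence_complex V H)"
proof (rule acyclic_edge_induct
    [where P = "\<lambda>V H m. \<forall>F\<subseteq>H. dominates H (\<Union>F) V \<longrightarrow> m \<le> int (card F)"])
  fix V :: "'a set" and H and m :: int
  assume H: "hypergraph V H" and "m > 0" and iso: "\<not> has_isolated_vertex V H"
    and bound: "\<forall>F\<subseteq>H. dominates H (\<Union>F) V \<longrightarrow> m \<le> int (card F)"
  have "\<not> dominates H {} V" using bound \<open>m > 0\<close> by (auto dest: spec[of _ "{}"])
  then obtain e where e: "e \<in> H" "2 \<le> card e" using large_edge_cases[OF H iso] by blast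
  have "m + 1 - int (card e) \<le> int (card F)"
    if F: "F \<subseteq> contract H e" "dominates (contract H e) (\<Union>F) (V - e)" for F
  proof -
    \<comment> \<open>One preimage is chosen for each edge of \<open>F\<close>, so \<open>F'\<close>
      and \<open>F\<close> have the same size.\<close>
    obtain F' where F': "F' \<subseteq> H - {e}" "inj_on (\<lambda>f. f - e) F'" "F = (\<lambda>f. f - e) ` F'"
      using F(1) unfolding contract_def subset_image_inj by blast
    have "dominates H (\<Union>F \<union> e) V" using dominates_contract e(1) F(2) by blast
    then have "dominates H (\<Union>(insert e F')) V"
      by (rule dominates_mono) (auto simp: F'(3))
    then have "m \<le> int (card (insert e F'))" using bound F'(1) e(1) by blast
    moreover have "finite F'" using F'(1) finite_edges[OF H] by (blast intro: finite_subset)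
    then have "card (insert e F') \<le> card F + 1"
      using F' by (simp add: card_image card_insert_if)
    ultimately show ?thesis using e(2) by linarith
  qed
  moreover have "m \<le> int (card F)" if "F \<subseteq> H - {e}" "dominates (H - {e}) (\<Union>F) V" for F
    using that bound dominates_mono[of "H - {e}" "\<Union>F" V H "\<Union>F"] by blast
  ultimately show "\<exists>e\<in>H. (\<forall>F\<subseteq>H - {e}. dominates (H - {e}) (\<Union>F) V \<longrightarrow> m \<le> int (card F)) \<and>
      ((\<forall>f\<in>H. f \<subseteq> e \<longrightarrow> f = e) \<longrightarrow>
        (\<forall>F\<subseteq>contract H e. dominates (contract H e) (\<Union>F) (V - e) \<longrightarrow> m + 1 - int (card e) \<le> int (card F)))"
    by (intro bexI[OF _ e(1)] conjI impI allI) blast+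
qed (use assms in auto)

lemma strongly_independent_edge_unique:
  assumes "hypergraph V H" "strongly_independent V H A" "f \<in> H" "x \<in> f" "x \<in> A" "y \<in> f" "y \<in> A"
  shows "x = y"
proof -
  have "card (f \<inter> A) \<le> Suc 0" "finite (f \<inter> A)"
    using assms(1-3) finite_edge by (auto simp: strongly_independent_def)
  then show ?thesis using assms by (auto simp: card_le_Suc0_iff_eq)
qed

text \<open>An edge \<open>f\<close> with \<open>f - e = {v}\<close> becomes a loop, so vertices
  dominated by \<open>e\<close> must leave \<open>A\<close>. This suffices: if \<open>f - e\<close>
  lies in \<open>A\<close>, strong independence makes it a single vertex, which \<open>e\<close>
  then dominates.\<close>

lemma strongly_independent_contract:
  assumes H: "hypergraph V H" and A: "strongly_independent V H A"
    and min: "\<forall>f\<in>H. f \<subseteq> e \<longrightarrow> f = e"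
  shows "strongly_independent (V - e) (contract H e) {v \<in> A - e. \<not> dominates_vertex H e v}"
    (is "strongly_independent _ _ ?A")
  unfolding strongly_independent_def independent_def
proof (intro conjI notI ballI)
  show "?A \<subseteq> V - e" using A by (auto simp: strongly_independent_def independent_def)
next
  assume "\<exists>g\<in>contract H e. g \<subseteq> ?A"
  then obtain f where f: "f \<in> H" "f \<noteq> e" "f - e \<subseteq> ?A" by (auto simp: contract_def)
  then obtain v where v: "v \<in> f" "v \<notin> e" using min by blast
  then have "f \<subseteq> insert v e"
    using f strongly_independent_edge_unique[OF H A f(1) v(1)] by blast
  then have "dominates_vertex H e v" using f v by (auto simp: dominates_vertex_iff)
  then show False using f v by blast
next
  fix g assume "g \<in> contract H e"
  then obtain f where f: "f \<in> H" "g = f - e" by (auto simp: contract_def)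
  have "finite (g \<inter> ?A)" using finite_edge[OF H f(1)] f(2) by simp
  moreover have "x = y" if "x \<in> g \<inter> ?A" "y \<in> g \<inter> ?A" for x y
    using strongly_independent_edge_unique[OF H A f(1)] that f(2) by blast
  ultimately show "card (g \<inter> ?A) \<le> 1" by (simp add: card_le_Suc0_iff_eq)
qed

text \<open>The contracted edge \<open>e\<close> passes through a vertex \<open>a\<close> of
  \<open>A\<close>. A dominating set of the contraction lifts by adding only \<open>e - {a}\<close>,
  so the cost \<open>card e - 1\<close> equals the drop of \<open>m\<close>, even for a
  loop.\<close>

lemma acyclic_strongly_independent_domination:
  assumes "hypergraph V H" "strongly_independent V H A"
    "\<And>W. W \<subseteq> V \<Longrightarrow> dominates H W A \<Longrightarrow> m \<le> int (card W)"
  shows "acyclic_upto (m - 2) (independence_complex V H)"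
proof (rule acyclic_edge_induct
    [where P = "\<lambda>V H m. \<exists>A. strongly_independent V H A \<and>
      (\<forall>W\<subseteq>V. dominates H W A \<longrightarrow> m \<le> int (card W))"])
  fix V :: "'a set" and H and m :: int
  assume H: "hypergraph V H" and "m > 0" and iso: "\<not> has_isolated_vertex V H"
    and "\<exists>A. strongly_independent V H A \<and> (\<forall>W\<subseteq>V. dominates H W A \<longrightarrow> m \<le> int (card W))"
  then obtain A where A: "strongly_independent V H A"
    and bound: "\<And>W. W \<subseteq> V \<Longrightarrow> dominates H W A \<Longrightarrow> m \<le> int (card W)" by blast
  \<comment> \<open>Positivity of \<open>m\<close> makes \<open>A\<close> nonempty, since the empty
    set dominates the empty set.\<close>
  have "\<not> dominates H {} A" using bound[of "{}"] \<open>m > 0\<close> by auto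
  then obtain a where a: "a \<in> A" by (auto simp: dominates_def)
  moreover have AV: "A \<subseteq> V" using A by (auto simp: strongly_independent_def independent_def)
  ultimately obtain e where e: "e \<in> H" "a \<in> e" using iso by (auto simp: has_isolated_vertex_def)
  have unique: "v = a" if "v \<in> A" "v \<in> f" "a \<in> f" "f \<in> H" for v f
    using strongly_independent_edge_unique[OF H A] a that by blast
  let ?A = "{v \<in> A - e. \<not> dominates_vertex H e v}"
  have con: "m + 1 - int (card e) \<le> int (card W)"
    if W: "W \<subseteq> V - e" "dominates (contract H e) W ?A" for W
  proof -
    have "dominates_vertex H (W \<union> (e - {a})) v" if v: "v \<in> A" for v
    proof -
      \<comment> \<open>\<open>e\<close> meets \<open>A\<close> only in \<open>a\<close>, so every
        other vertex of \<open>A\<close> lies outside \<open>e\<close>.\<close>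
      consider "v = a" | "v \<noteq> a" "dominates_vertex H e v" | "v \<in> ?A"
        using unique[OF v _ e(2) e(1)] v by blast
      then show ?thesis
      proof cases
        case 1
        then show ?thesis using e by (auto simp: dominates_vertex_iff)
      next
        case 2
        then obtain f where f: "f \<in> H" "v \<in> f" "f \<subseteq> insert v e" by (auto simp: dominates_vertex_iff)
        \<comment> \<open>By strong independence an edge through \<open>v\<close> avoids
          \<open>a\<close>, so \<open>e - {a}\<close> serves as well as \<open>e\<close>.\<close>
        moreover have "a \<notin> f" using unique[OF v f(2) _ f(1)] 2 by blast
        ultimately have "f \<subseteq> insert v (W \<union> (e - {a}))" by blast
        then show ?thesis using f(1,2) unfolding dominates_vertex_iff by blast
      next
        case 3
        then have "dominates_vertex (contract H e) W v" using W(2) unfolding dominates_def by blast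
        then obtain f where f: "f \<in> H" "v \<in> f" "f - e \<subseteq> insert v W"
          by (auto simp: dominates_vertex_iff contract_def)
        moreover have "a \<notin> f" using unique[OF v f(2) _ f(1)] 3 e(2) by blast
        ultimately have "f \<subseteq> insert v (W \<union> (e - {a}))" by blast
        then show ?thesis using f(1,2) unfolding dominates_vertex_iff by blast
      qed
    qed
    then have "dominates H (W \<union> (e - {a})) A" by (simp add: dominates_def)
    moreover have "W \<union> (e - {a}) \<subseteq> V" using W e H by (auto simp: hypergraph_def)
    ultimately have "m \<le> int (card (W \<union> (e - {a})))" using bound by blast
    moreover have "card e = Suc (card (e - {a}))"
      using finite_edge[OF H e(1)] e(2) by (rule card.remove)
    ultimately show ?thesis using card_Un_le[of W "e - {a}"] by linarith
  qed
  have del: "m \<le> int (card W)" if "W \<subseteq> V" "dominates (H - {e}) W A" for W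
    using that bound dominates_mono[of "H - {e}" W A H W] by blast
  have si: "strongly_independent V (H - {e}) A"
    using A by (auto simp: strongly_independent_def independent_def)
  show "\<exists>e\<in>H. (\<exists>A. strongly_independent V (H - {e}) A \<and>
        (\<forall>W\<subseteq>V. dominates (H - {e}) W A \<longrightarrow> m \<le> int (card W))) \<and>
      ((\<forall>f\<in>H. f \<subseteq> e \<longrightarrow> f = e) \<longrightarrow>
        (\<exists>A. strongly_independent (V - e) (contract H e) A \<and>
          (\<forall>W\<subseteq>V - e. dominates (contract H e) W A \<longrightarrow> m + 1 - int (card e) \<le> int (card W))))"
  proof (intro bexI[OF _ e(1)] conjI impI)
    show "\<exists>A. strongly_independent V (H - {e}) A \<and>
        (\<forall>W\<subseteq>V. dominates (H - {e}) W A \<longrightarrow> m \<le> int (card W))"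
      using si del by (intro exI[of _ A]) auto
  next
    assume "\<forall>f\<in>H. f \<subseteq> e \<longrightarrow> f = e"
    then have "strongly_independent (V - e) (contract H e) ?A"
      by (rule strongly_independent_contract[OF H A])
    then show "\<exists>A. strongly_independent (V - e) (contract H e) A \<and>
        (\<forall>W\<subseteq>V - e. dominates (contract H e) W A \<longrightarrow> m + 1 - int (card e) \<le> int (card W))"
      using con by (intro exI[of _ ?A] conjI) blast+
  qed
qed (use assms in auto)

section \<open>The bound on the connectivity\<close>

lemma acyclic_le_eta:
  assumes "hypergraph V H" "acyclic_upto (int n - 2) (independence_complex V H)"
  shows "enat n \<le> eta (independence_complex V H)"
  using assms homologically_connectedI simplicial_complex_independence homologically_connected_le_eta
  by blast

text \<open>Reduces comparisons with \<open>eta\<close> to finite \<open>n\<close>, where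
  connectivity up to degree \<open>n - 2\<close> is enough; infinite values are covered as
  well.\<close>

lemma enat_le_iff_all: "x \<le> y \<longleftrightarrow> (\<forall>n. enat n \<le> x \<longrightarrow> enat n \<le> y)"
proof
  assume *: "\<forall>n. enat n \<le> x \<longrightarrow> enat n \<le> y"
  show "x \<le> y"
  proof (cases x; cases y)
    fix m assume "x = \<infinity>" "y = enat m"
    then show ?thesis using *[rule_format, of "Suc m"] by simp
  qed (use * in auto)
qed (meson order_trans)

lemma eta_isolated:
  assumes "hypergraph V H" "has_isolated_vertex V H"
  shows "eta (independence_complex V H) = \<infinity>"
proof -
  have "\<infinity> \<le> eta (independence_complex V H)"
    unfolding enat_le_iff_all[of \<infinity>] using acyclic_le_eta acyclic_isolated assms by blast
  then show ?thesis by simp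
qed

lemma ceil_half_gamma_tilde_le_eta:
  assumes "hypergraph V H"
  shows "ceil_half (gamma_tilde V H) \<le> eta (independence_complex V H)"
proof (cases "has_isolated_vertex V H")
  case False
  show ?thesis
    unfolding enat_le_iff_all[of "ceil_half _"]
  proof (intro allI impI)
    fix n assume n: "enat n \<le> ceil_half (gamma_tilde V H)"
    have "2 * int n \<le> int (card W) + 1" if W: "W \<subseteq> V" "dominates H W V" for W
    proof -
      have "gamma_tilde V H \<le> enat (card W)"
        using W False by (auto simp: gamma_tilde_def domination_number_def intro: INF_lower)
      then obtain g where g: "gamma_tilde V H = enat g" "g \<le> card W"
        by (metis enat_ile enat_ord_simps(1))
      \<comment> \<open>For integers this bound means \<open>2 * n \<le> g + 1\<close>.\<close>
      then have "n \<le> nat \<lceil>real g / 2\<rceil>" using n by (simp add: ceil_half_def)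
      then show ?thesis using g(2) by linarith
    qed
    then show "enat n \<le> eta (independence_complex V H)"
      by (intro acyclic_le_eta[OF assms] acyclic_total_domination[OF assms])
  qed
qed (simp add: eta_isolated assms)

lemma gamma_si_le_eta:
  assumes "hypergraph V H"
  shows "gamma_si V H \<le> eta (independence_complex V H)"
proof (cases "has_isolated_vertex V H")
  case False
  \<comment> \<open>\<open>Max\<close> is bounded elementwise over a finite nonempty set; the empty
    set belongs to it because edges are nonempty.\<close>
  have "finite {A. strongly_independent V H A}"
    by (rule finite_subset[of _ "Pow V"])
      (use assms in \<open>auto simp: strongly_independent_def independent_def hypergraph_def\<close>)
  moreover have "strongly_independent V H {}"
    using assms by (auto simp: strongly_independent_def independent_def hypergraph_def)
  moreover have "domination_number V H A \<le> eta (independence_complex V H)"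
    if A: "strongly_independent V H A" for A
    unfolding enat_le_iff_all[of "domination_number V H A"]
  proof (intro allI impI)
    fix n assume "enat n \<le> domination_number V H A"
    then have "int n \<le> int (card W)" if "W \<subseteq> V" "dominates H W A" for W
      using that by (auto simp: domination_number_def le_INF_iff)
    then show "enat n \<le> eta (independence_complex V H)"
      by (intro acyclic_le_eta[OF assms] acyclic_strongly_independent_domination[OF assms A])
  qed
  ultimately have "Max (domination_number V H ` {A. strongly_independent V H A}) \<le> eta (independence_complex V H)"
    by (intro Max.boundedI) auto
  then show ?thesis using False by (simp add: gamma_si_def)
qed (simp add: eta_isolated assms)

lemma gamma_E_le_eta:
  assumes "hypergraph V H"
  shows "gamma_E V H \<le> eta (independence_complex V H)"
proof (cases "has_isolated_vertex V H")
  case False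
  show ?thesis
    unfolding enat_le_iff_all[of "gamma_E V H"]
  proof (intro allI impI)
    fix n assume "enat n \<le> gamma_E V H"
    then have "int n \<le> int (card F)" if "F \<subseteq> H" "dominates H (\<Union>F) V" for F
      using that False by (auto simp: gamma_E_def le_INF_iff)
    then show "enat n \<le> eta (independence_complex V H)"
      by (intro acyclic_le_eta[OF assms] acyclic_edge_domination[OF assms])
  qed
qed (simp add: eta_isolated assms)

theorem corollary1p5:
  fixes V :: "'a set" and H :: "'a set set"
  assumes "hypergraph V H"
  shows "eta (independence_complex V H) \<ge>
           Max {ceil_half (gamma_tilde V H), gamma_si V H, gamma_E V H}"
  using ceil_half_gamma_tilde_le_eta[OF assms] gamma_si_le_eta[OF assms] gamma_E_le_eta[OF assms] by simp

end
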